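(* There is a function $c:(0,\infty)\to(0,\infty)$ such that the following holds. Let $n\ge 1$ be an integer and let $\Omega$ be a bounded open domain in $\mathbb{R}^{n+1}$ with boundary $\partial\Omega$. Then for each real $m\in(0,n]$, $$\mathrm{HC}_m(\Omega)\le c(m)\,\mathrm{HC}_m(\partial\Omega).$$ The constant $c(m)$ depends only on $m$, not on the dimension $n+1$ of the ambient space.
   Context: For a subset $A$ of a metric space and a real $m\ge 0$, the $m$-dimensional Hausdorff content $\mathrm{HC}_m(A)$ is the infimum of $\sum_i r_i^m$ over all coverings of $A$ by collections of metric balls $B_i$, where $r_i$ is the radius of $B_i$. Here the metric on $\mathbb{R}^{n+1}$ is the Euclidean one. *)

theory Defs
  imports "HOL-Analysis.Analysis"
begin

text \<open>Euclidean space R^(n+1) is modelled as the carrier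
  topspace (Euclidean_space (Suc n)) = {x :: nat => real. for all i > n, x i = 0}
  (coordinates 0..n), with the library topology Euclidean_space (Suc n)
  and the Euclidean distance below.\<close>

definition edist :: "nat \<Rightarrow> (nat \<Rightarrow> real) \<Rightarrow> (nat \<Rightarrow> real) \<Rightarrow> real" where
  "edist n x y = sqrt (\<Sum>i\<le>n. (x i - y i)\<^sup>2)"

definition RR :: "nat \<Rightarrow> (nat \<Rightarrow> real) set" where
  "RR n = topspace (Euclidean_space (Suc n))"

definition eball :: "nat \<Rightarrow> (nat \<Rightarrow> real) \<Rightarrow> real \<Rightarrow> (nat \<Rightarrow> real) set" where
  "eball n x r = {y \<in> RR n. edist n x y < r}"

definition ebounded :: "nat \<Rightarrow> (nat \<Rightarrow> real) set \<Rightarrow> bool" where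
  "ebounded n S \<longleftrightarrow> (\<exists>x\<in>RR n. \<exists>r. S \<subseteq> eball n x r)"

definition HC :: "nat \<Rightarrow> real \<Rightarrow> (nat \<Rightarrow> real) set \<Rightarrow> ennreal" where
  "HC n m A = Inf {(\<Sum>i. ennreal (r i powr m)) | x r.
      (\<forall>i. x i \<in> RR n \<and> r i \<ge> 0) \<and> A \<subseteq> (\<Union>i. eball n (x i) (r i))}"

end

theory Submission
  imports Defs
begin

text \<open>
  Cover the compact boundary by finitely many balls \<open>B(x\<^sub>i, r\<^sub>i)\<close> and put \<open>k = \<lceil>m\<rceil> \<le> n\<close>. The key
  claim is that every \<open>p \<in> \<Omega>\<close> has a scale \<open>\<rho>\<close> such that the balls within distance \<open>(k + 1) \<rho>\<close> of \<open>p\<close>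
  satisfy \<open>\<Sum> r\<^sub>i\<^sup>k \<ge> c(k) \<rho>\<^sup>k\<close>. Only the \<open>(k + 1)\<close>-dimensional coordinate slice through \<open>p\<close> is used
  for this, and so no constant depends on \<open>n\<close>.

  In the slice take a fine lattice with corner \<open>p\<close> and the cubes with corner \<open>p\<close> of \<open>2\<^sup>s\<close> lattice
  points per edge. At \<open>s = 0\<close> all points of the cube are in \<open>\<Omega>\<close>, for large \<open>s\<close> less than half, so at
  the first \<open>s\<close> where at most half are in \<open>\<Omega>\<close> both \<open>\<Omega>\<close> and its complement have a definite
  proportion. Joining pairs of lattice points by changing one coordinate at a time shows that a
  definite proportion of the axis-parallel lines of the cube meet the boundary, and a ball of
  radius \<open>r\<close> blocks only about \<open>r\<^sup>k\<close> of them.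

  A greedy Vitali selection with respect to the weights \<open>r\<^sub>i\<^sup>m\<close> then covers the points of \<open>\<Omega>\<close> outside
  the doubled balls \<open>B(x\<^sub>i, 2 r\<^sub>i)\<close>.
\<close>

section \<open>Euclidean distance and topology of the ambient space\<close>

lemma edist_L2_set: "edist n x y = L2_set (\<lambda>i. x i - y i) {..n}"
  by (simp add: edist_def L2_set_def)

lemma edist_nonneg: "0 \<le> edist n x y"
  by (simp add: edist_L2_set)

lemma edist_commute: "edist n x y = edist n y x"
  by (simp add: edist_def power2_commute)

lemma edist_triangle: "edist n x z \<le> edist n x y + edist n y z"
  using L2_set_triangle_ineq[of "\<lambda>i. x i - y i" "\<lambda>i. y i - z i" "{..n}"]
  by (simp add: edist_L2_set)

lemma coordinate_le_edist:
  assumes "i \<le> n"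
  shows "\<bar>x i - y i\<bar> \<le> edist n x y"
proof -
  have "\<bar>x i - y i\<bar> = sqrt ((x i - y i)\<^sup>2)" by simp
  also have "\<dots> \<le> edist n x y"
    unfolding edist_def using assms
    by (intro real_sqrt_le_mono member_le_sum) auto
  finally show ?thesis .
qed

lemma edist_le_sum_abs: "edist n x y \<le> (\<Sum>i\<le>n. \<bar>x i - y i\<bar>)"
  by (simp add: edist_L2_set L2_set_le_sum_abs)

lemma RR_iff: "x \<in> RR n \<longleftrightarrow> (\<forall>i>n. x i = 0)"
  by (auto simp: RR_def topspace_Euclidean_space Suc_le_eq)

lemma Euclidean_space_eq_top_of_set: "Euclidean_space (Suc n) = top_of_set (RR n)"
  unfolding Euclidean_space_def euclidean_product_topology
  by (rule arg_cong2[where f=subtopology]) (auto simp: RR_iff Suc_le_eq)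

lemma continuous_on_edist: "continuous_on UNIV (edist n x)"
  unfolding edist_def by (intro continuous_intros continuous_on_product_coordinates)

lemma open_edist_less: "open {y. edist n x y < r}"
  by (intro open_Collect_less continuous_on_edist continuous_on_const)

lemma compact_box: "compact (PiE (UNIV :: nat set) (\<lambda>i. {a i..b i :: real}))"
proof -
  have "compactin (product_topology (\<lambda>i::nat. euclideanreal) UNIV) (PiE UNIV (\<lambda>i. {a i..b i}))"
    by (subst compactin_PiE) auto
  then show ?thesis
    by (simp add: euclidean_product_topology)
qed

text \<open>The frontier is closed and lies in a product of compact intervals: side
  \<open>2 * R\<close> in the coordinates up to \<open>n\<close>, the point 0 beyond. Such a box is
  compact in the product topology.\<close>

lemma compact_frontier_of_ebounded:
  assumes "ebounded n \<Omega>"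
  shows "compact (Euclidean_space (Suc n) frontier_of \<Omega>)"
proof -
  obtain u R where u: "\<Omega> \<subseteq> eball n u R"
    using assms by (auto simp: ebounded_def)
  define K where "K = PiE (UNIV :: nat set)
     (\<lambda>i. {if i \<le> n then u i - R else 0..if i \<le> n then u i + R else (0::real)})"
  have K: "compact K"
    unfolding K_def by (rule compact_box)
  have "\<Omega> \<subseteq> K"
  proof
    fix y assume "y \<in> \<Omega>"
    then have y: "y \<in> RR n" "edist n u y < R"
      using u by (auto simp: eball_def)
    have "\<bar>u i - y i\<bar> < R" if "i \<le> n" for i
      using coordinate_le_edist[OF that, of u y] y(2) by linarith
    then show "y \<in> K"
      using y(1) by (fastforce simp: K_def RR_iff abs_less_iff)
  qed
  have KR: "K \<subseteq> RR n"
    by (force simp: K_def RR_iff PiE_iff split: if_splits)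
  have "closed K"
    using K by (rule compact_imp_closed)
  then have "closedin (Euclidean_space (Suc n)) K"
    unfolding Euclidean_space_eq_top_of_set using KR by (intro closed_subset)
  then have "Euclidean_space (Suc n) frontier_of \<Omega> \<subseteq> K"
    using closure_of_minimal[OF \<open>\<Omega> \<subseteq> K\<close>] unfolding frontier_of_def by (metis Diff_subset order_trans)
  moreover have "closed (Euclidean_space (Suc n) frontier_of \<Omega>)"
  proof -
    have "closedin (top_of_set K) (Euclidean_space (Suc n) frontier_of \<Omega>)"
      using closedin_frontier_of[of "Euclidean_space (Suc n)" \<Omega>] KR calculation
      by (metis Euclidean_space_eq_top_of_set closedin_subset_trans)
    then show ?thesis
      using \<open>closed K\<close> closedin_closed_trans by blast
  qed
  ultimately show ?thesis
    using K by (metis compact_Int_closed inf.absorb2)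
qed

text \<open>An axis-parallel segment is connected and meets both \<Omega> and its complement. This
  turns a change of membership between two lattice points into a frontier point on their common
  line.\<close>

lemma segment_meets_frontier:
  assumes "q \<in> RR n" "j \<le> n" "q(j := a) \<in> \<Omega>" "q(j := b) \<notin> \<Omega>"
  shows "\<exists>t\<in>closed_segment a b. q(j := t) \<in> Euclidean_space (Suc n) frontier_of \<Omega>"
proof -
  let ?S = "(\<lambda>t. q(j := t)) ` closed_segment a b"
  have "continuous_on (closed_segment a b) (\<lambda>t. q(j := t))"
  proof (rule continuous_on_coordinatewise_then_product)
    fix i show "continuous_on (closed_segment a b) (\<lambda>t. (q(j := t)) i)"
      by (cases "i = j") auto
  qed
  then have "connected ?S"
    by (intro connected_continuous_image) auto
  moreover have "?S \<subseteq> RR n"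
    using assms(1,2) by (auto simp: RR_iff)
  ultimately have "connectedin (Euclidean_space (Suc n)) ?S"
    by (simp add: Euclidean_space_eq_top_of_set connectedin_subtopology)
  then have "?S \<inter> Euclidean_space (Suc n) frontier_of \<Omega> \<noteq> {}"
    using assms(3,4) by (intro connectedin_Int_frontier_of) auto
  then show ?thesis by auto
qed

section \<open>Finite covers and greedy selection\<close>

lemma HC_le_finite_sum:
  assumes "finite J" "\<And>j. j \<in> J \<Longrightarrow> x j \<in> RR n" "\<And>j. j \<in> J \<Longrightarrow> 0 \<le> r j"
    and "A \<subseteq> (\<Union>j\<in>J. eball n (x j) (r j))"
  shows "HC n m A \<le> ennreal (\<Sum>j\<in>J. r j powr m)"
proof -
  obtain e where e: "bij_betw e {..<card J} J"
    using ex_bij_betw_nat_finite[OF assms(1)] by (auto simp: atLeast0LessThan)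
  define x' where "x' i = (if i < card J then x (e i) else (\<lambda>_. 0))" for i
  \<comment> \<open>Radius 0 pads the finite family to a sequence: such balls are empty and cost
    \<open>0 powr m = 0\<close>.\<close>
  define r' where "r' i = (if i < card J then r (e i) else 0)" for i
  have eJ: "e i \<in> J" if "i < card J" for i
    using e that by (auto simp: bij_betw_def)
  have "(\<Sum>i. ennreal (r' i powr m)) = (\<Sum>i<card J. ennreal (r' i powr m))"
    by (intro suminf_finite) (auto simp: r'_def)
  also have "\<dots> = (\<Sum>i<card J. ennreal (r (e i) powr m))"
    by (intro sum.cong) (auto simp: r'_def)
  also have "\<dots> = (\<Sum>j\<in>J. ennreal (r j powr m))"
    by (rule sum.reindex_bij_betw[OF e])
  also have "\<dots> = ennreal (\<Sum>j\<in>J. r j powr m)"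
    by simp
  finally have "ennreal (\<Sum>j\<in>J. r j powr m) = (\<Sum>i. ennreal (r' i powr m))" ..
  moreover have "\<forall>i. x' i \<in> RR n \<and> r' i \<ge> 0"
    using assms(2,3) eJ by (auto simp: x'_def r'_def RR_iff)
  moreover have "A \<subseteq> (\<Union>i. eball n (x' i) (r' i))"
  proof
    fix a assume "a \<in> A"
    then obtain j where j: "j \<in> J" "a \<in> eball n (x j) (r j)"
      using assms(4) by auto
    have "j \<in> e ` {..<card J}"
      using e j(1) by (simp add: bij_betw_def)
    then obtain i where "i < card J" "e i = j"
      by (metis imageE lessThan_iff)
    then show "a \<in> (\<Union>i. eball n (x' i) (r' i))"
      using j by (intro UN_I[of i]) (auto simp: x'_def r'_def)
  qed
  ultimately show ?thesis
    unfolding HC_def by (intro Inf_lower) auto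
qed

text \<open>Choose \<open>p\<close> whose \<sigma> exceeds half the supremum, charge it to the
  weights in \<open>S p\<close>, and recurse on the points whose sets avoid \<open>S p\<close>. A
  discarded \<open>q\<close> shares an index with \<open>p\<close>, so its distance to
  \<open>p\<close> is at most \<open>\<sigma> p + \<sigma> q < 3 * \<sigma> p\<close>. The charged
  sets are disjoint, hence the total stays below \<open>sum w I\<close>. \<open>P\<close> may be
  infinite; the induction runs over \<open>I\<close>.\<close>

lemma greedy_covering:
  fixes \<sigma> :: "(nat \<Rightarrow> real) \<Rightarrow> real" and w :: "'i \<Rightarrow> real"
  assumes "finite I" "\<And>i. i \<in> I \<Longrightarrow> 0 \<le> w i" "0 < c" "0 < m"
    and "\<And>p. p \<in> P \<Longrightarrow> 0 < \<sigma> p" "\<And>p. p \<in> P \<Longrightarrow> S p \<subseteq> I"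
    and "\<And>p i. p \<in> P \<Longrightarrow> i \<in> S p \<Longrightarrow> edist n p (x i) \<le> \<sigma> p"
    and "\<And>p. p \<in> P \<Longrightarrow> c * \<sigma> p powr m \<le> sum w (S p)"
  shows "\<exists>Q. finite Q \<and> Q \<subseteq> P \<and> (\<forall>p\<in>P. \<exists>q\<in>Q. edist n q p < 3 * \<sigma> q) \<and>
           (\<Sum>q\<in>Q. c * \<sigma> q powr m) \<le> sum w I"
  using assms(1,2,5-)
proof (induction I arbitrary: P rule: finite_psubset_induct)
  case (psubset I)
  show ?case
  proof (cases "P = {}")
    case True
    then show ?thesis
      using psubset.prems(1) by (intro exI[of _ "{}"]) (auto intro: sum_nonneg)
  next
    case False
    \<comment> \<open>The total weight bounds \<sigma>, so the supremum used in the greedy choice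
      exists.\<close>
    have "\<sigma> p \<le> (sum w I / c) powr (1 / m)" if p: "p \<in> P" for p
    proof -
      have "c * \<sigma> p powr m \<le> sum w I"
        using psubset.prems(5)[OF p] sum_mono2[OF psubset.hyps(1) psubset.prems(3)[OF p], of w]
          psubset.prems(1) by force
      then have "\<sigma> p powr m \<le> sum w I / c"
        using \<open>0 < c\<close> by (simp add: field_simps)
      then have "(\<sigma> p powr m) powr (1 / m) \<le> (sum w I / c) powr (1 / m)"
        using \<open>0 < m\<close> by (intro powr_mono2) auto
      then show ?thesis
        using psubset.prems(2)[OF p] \<open>0 < m\<close> by (simp add: powr_powr)
    qed
    then have bdd: "bdd_above (\<sigma> ` P)"
      by (rule bdd_aboveI2)
    have "0 < Sup (\<sigma> ` P)"
      using False psubset.prems(2) bdd by (meson all_not_in_conv cSUP_upper less_le_trans)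
    then have "Sup (\<sigma> ` P) / 2 < Sup (\<sigma> ` P)" by simp
    then obtain p where p: "p \<in> P" "Sup (\<sigma> ` P) / 2 < \<sigma> p"
      using less_cSUP_iff[OF False bdd] by blast
    have half: "\<sigma> q < 2 * \<sigma> p" if "q \<in> P" for q
      using cSUP_upper[OF that bdd] p(2) by linarith
    \<comment> \<open>A nonempty \<open>S p\<close> makes the remaining index set strictly
      smaller.\<close>
    have Sne: "S p \<noteq> {}"
      using psubset.prems(5)[OF p(1)] psubset.prems(2)[OF p(1)] \<open>0 < c\<close>
      by (metis less_le_not_le mult_pos_pos powr_gt_zero sum.empty order_less_irrefl)
    define P' where "P' = {q \<in> P. S q \<inter> S p = {}}"
    have "\<exists>Q. finite Q \<and> Q \<subseteq> P' \<and> (\<forall>p\<in>P'. \<exists>q\<in>Q. edist n q p < 3 * \<sigma> q) \<and>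
           (\<Sum>q\<in>Q. c * \<sigma> q powr m) \<le> sum w (I - S p)"
    proof (rule psubset.IH)
      show "I - S p \<subset> I"
        using Sne psubset.prems(3)[OF p(1)] by blast
      show "S q \<subseteq> I - S p" if "q \<in> P'" for q
        using psubset.prems(3)[of q] that by (auto simp: P'_def)
    qed (use psubset.prems in \<open>auto simp: P'_def\<close>)
    then obtain Q where Q: "finite Q" "Q \<subseteq> P'" "\<forall>p\<in>P'. \<exists>q\<in>Q. edist n q p < 3 * \<sigma> q"
       "(\<Sum>q\<in>Q. c * \<sigma> q powr m) \<le> sum w (I - S p)"
      by blast
    have "p \<notin> Q"
      using Q(2) Sne by (auto simp: P'_def)
    have "edist n p q < 3 * \<sigma> p" if q: "q \<in> P" "q \<notin> P'" for q
    proof -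
      obtain i where i: "i \<in> S q" "i \<in> S p"
        using q by (auto simp: P'_def)
      have "edist n p q \<le> edist n p (x i) + edist n q (x i)"
        using edist_triangle[of n p q "x i"] by (simp add: edist_commute)
      also have "\<dots> \<le> \<sigma> p + \<sigma> q"
        using psubset.prems(4) i p(1) q(1) by (intro add_mono) auto
      finally show ?thesis
        using half[OF q(1)] by linarith
    qed
    then have "\<forall>q\<in>P. \<exists>q'\<in>insert p Q. edist n q' q < 3 * \<sigma> q'"
      using Q(3) by blast
    moreover have "(\<Sum>q\<in>insert p Q. c * \<sigma> q powr m) \<le> sum w (S p) + sum w (I - S p)"
      using Q(1,4) \<open>p \<notin> Q\<close> psubset.prems(5)[OF p(1)] by simp
    then have "(\<Sum>q\<in>insert p Q. c * \<sigma> q powr m) \<le> sum w I"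
      using sum.subset_diff[OF psubset.prems(3)[OF p(1)] psubset.hyps(1), of w] by simp
    ultimately show ?thesis
      using Q(1,2) p(1) by (intro exI[of _ "insert p Q"]) (auto simp: P'_def)
  qed
qed

section \<open>Discrete isoperimetry in a cube of dimension \<open>k + 1\<close>\<close>

lemma first_switch:
  fixes g :: "nat \<Rightarrow> bool"
  assumes "g 0" "\<not> g d"
  shows "\<exists>j<d. g j \<and> \<not> g (Suc j)"
  using assms by (induction d) (auto intro: less_SucI)

definition grid :: "nat \<Rightarrow> nat \<Rightarrow> (nat \<Rightarrow> nat) set" where
  "grid k N = PiE {..k} (\<lambda>_. {..<N})"

text \<open>A line parallel to axis \<open>j\<close> is encoded by its other \<open>k\<close>
  coordinates.\<close>

definition cut_lines :: "nat \<Rightarrow> nat \<Rightarrow> ((nat \<Rightarrow> nat) \<Rightarrow> bool) \<Rightarrow> nat \<Rightarrow> (nat \<Rightarrow> nat) set" where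
  "cut_lines k N f j =
     {b \<in> PiE ({..k} - {j}) (\<lambda>_. {..<N}). \<exists>s<N. \<exists>t<N. f (b(j := s)) \<and> \<not> f (b(j := t))}"

lemma finite_grid: "finite (grid k N)"
  by (auto simp: grid_def intro: finite_PiE)

lemma card_grid: "card (grid k N) = N ^ Suc k"
  by (simp add: grid_def card_PiE)

lemma finite_cut_lines: "finite (cut_lines k N f j)"
  by (rule finite_subset[of _ "PiE ({..k} - {j}) (\<lambda>_. {..<N})"])
     (auto simp: cut_lines_def intro: finite_PiE)

text \<open>Each pair \<open>(z, w)\<close> with \<open>f z\<close> and \<open>\<not> f w\<close> is
  joined by replacing the coordinates of \<open>z\<close> by those of \<open>w\<close> one at a
  time; \<open>f\<close> switches at some step \<open>j\<close>, along a cut line. That line fixes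
  \<open>k\<close> of the \<open>2 * k + 2\<close> coordinates of the pair, so it serves at most
  \<open>N ^ (k + 2)\<close> pairs.\<close>

lemma grid_isoperimetry:
  fixes f :: "(nat \<Rightarrow> nat) \<Rightarrow> bool"
  shows "card {z \<in> grid k N. f z} * card {z \<in> grid k N. \<not> f z}
     \<le> N ^ (k + 2) * (\<Sum>j\<le>k. card (cut_lines k N f j))"
proof -
  \<comment> \<open>The path runs from \<open>z\<close> at index 0 to \<open>w\<close> at index
    \<open>Suc k\<close>. Its points \<open>j\<close> and \<open>Suc j\<close> can differ only in
    coordinate \<open>j\<close>, which \<open>base\<close> forgets.\<close>
  define v where "v z w j = (\<lambda>i\<in>{..k}. if i < j then w i else z i :: nat)" for z w and j :: nat
  define base where "base z w j = restrict (v z w j) ({..k} - {j})" for z w j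
  define D where "D j = {(z, w). z \<in> grid k N \<and> w \<in> grid k N \<and> base z w j \<in> cut_lines k N f j}" for j
  have "{z \<in> grid k N. f z} \<times> {z \<in> grid k N. \<not> f z} \<subseteq> (\<Union>j\<le>k. D j)"
  proof clarify
    fix z w assume zw: "z \<in> grid k N" "f z" "w \<in> grid k N" "\<not> f w"
    have v0: "v z w 0 = z" and vk: "v z w (Suc k) = w"
      using zw(1,3) by (auto simp: v_def grid_def fun_eq_iff PiE_iff extensional_def)
    then obtain j where j: "j < Suc k" "f (v z w j)" "\<not> f (v z w (Suc j))"
      using first_switch[of "\<lambda>j. f (v z w j)" "Suc k"] zw by auto
    have 1: "(base z w j)(j := z j) = v z w j" "(base z w j)(j := w j) = v z w (Suc j)"
      using j(1) by (auto simp: base_def v_def fun_eq_iff less_Suc_eq)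
    have "z j < N" "w j < N" "base z w j \<in> PiE ({..k} - {j}) (\<lambda>_. {..<N})"
      using zw j(1) by (auto simp: grid_def base_def v_def PiE_iff)
    moreover have "f ((base z w j)(j := z j))" "\<not> f ((base z w j)(j := w j))"
      unfolding 1 using j by auto
    ultimately have "base z w j \<in> cut_lines k N f j"
      unfolding cut_lines_def by blast
    then show "(z, w) \<in> (\<Union>j\<le>k. D j)"
      using j zw by (auto simp: D_def)
  qed
  moreover have finD: "finite (D j)" for j
    by (rule finite_subset[of _ "grid k N \<times> grid k N"]) (auto simp: D_def finite_grid)
  ultimately have "card ({z \<in> grid k N. f z} \<times> {z \<in> grid k N. \<not> f z}) \<le> card (\<Union>j\<le>k. D j)"
    by (intro card_mono) auto
  also have "\<dots> \<le> (\<Sum>j\<le>k. card (D j))"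
    by (intro card_UN_le) auto
  also have "\<dots> \<le> (\<Sum>j\<le>k. N ^ (k + 2) * card (cut_lines k N f j))"
  proof (intro sum_mono)
    fix j assume j: "j \<in> {..k}"
    \<comment> \<open>The base point records \<open>w\<close> below \<open>j\<close> and \<open>z\<close> above \<open>j\<close>; the second component records the rest
      except \<open>w j\<close>.\<close>
    define \<phi> where "\<phi> = (\<lambda>(z, w). (base z w j, v w z (Suc j), w j))"
    have "inj_on \<phi> (D j)"
    proof (rule inj_onI, clarify)
      fix z w z' w'
      assume "(z, w) \<in> D j" "(z', w') \<in> D j" and eq: "\<phi> (z, w) = \<phi> (z', w')"
      then have g: "z \<in> grid k N" "w \<in> grid k N" "z' \<in> grid k N" "w' \<in> grid k N"
        by (auto simp: D_def)
      have b: "base z w j = base z' w' j" and v: "v w z (Suc j) = v w' z' (Suc j)" and jj: "w j = w' j"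
        using eq by (auto simp: \<phi>_def)
      have "z i = z' i \<and> w i = w' i" if "i \<le> k" for i
        using fun_cong[OF b, of i] fun_cong[OF v, of i] jj that
        by (cases i j rule: linorder_cases) (auto simp: base_def v_def)
      then show "z = z' \<and> w = w'"
        using g unfolding grid_def
        by (intro conjI PiE_ext[of _ "{..k}" "\<lambda>_. {..<N}"]) auto
    qed
    moreover have "\<phi> ` D j \<subseteq> cut_lines k N f j \<times> grid k N \<times> {..<N}"
      using j by (auto simp: \<phi>_def D_def grid_def v_def PiE_iff split: if_splits)
    ultimately have "card (D j) \<le> card (cut_lines k N f j \<times> grid k N \<times> {..<N})"
      by (intro card_inj_on_le) (auto simp: finite_cut_lines finite_grid)
    then show "card (D j) \<le> N ^ (k + 2) * card (cut_lines k N f j)"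
      by (simp add: card_cartesian_product card_grid algebra_simps)
  qed
  finally show ?thesis
    by (simp add: card_cartesian_product sum_distrib_left)
qed

section \<open>Boundary mass near a point of the domain\<close>

text \<open>An interval of length \<open>2 * r\<close> holds at most \<open>1 + 2 * r / h\<close>
  points of spacing \<open>h\<close>, and \<open>h \<le> r\<close> absorbs the 1 into
  \<open>r / h\<close>.\<close>

lemma grid_points_in_interval:
  fixes a r h :: real
  assumes "0 < h" "h \<le> r"
  shows "finite {z::nat. \<bar>a - h * real z\<bar> < r}"
    and "real (card {z::nat. \<bar>a - h * real z\<bar> < r}) \<le> 3 * r / h"
proof -
  let ?A = "{z::nat. \<bar>a - h * real z\<bar> < r}"
  define z0 where "z0 = (LEAST z. z \<in> ?A)"
  have A: "?A \<subseteq> {z0..z0 + nat \<lfloor>2 * r / h\<rfloor>}"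
  proof
    fix z assume z: "z \<in> ?A"
    then have z0: "z0 \<in> ?A" "z0 \<le> z"
      unfolding z0_def by (rule LeastI, rule Least_le)
    have "h * (real z - real z0) < 2 * r"
      using z z0(1) by (auto simp: algebra_simps abs_less_iff)
    then have "real z - real z0 \<le> 2 * r / h"
      using assms by (simp add: field_simps)
    then have "int z - int z0 \<le> \<lfloor>2 * r / h\<rfloor>"
      by (simp add: le_floor_iff)
    then show "z \<in> {z0..z0 + nat \<lfloor>2 * r / h\<rfloor>}"
      using z0(2) by auto
  qed
  then show "finite ?A"
    by (rule finite_subset) simp
  have "card ?A \<le> card {z0..z0 + nat \<lfloor>2 * r / h\<rfloor>}"
    using A by (intro card_mono) auto
  then have "real (card ?A) \<le> 1 + real (nat \<lfloor>2 * r / h\<rfloor>)"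
    by simp
  also have "\<dots> \<le> r / h + 2 * r / h"
    using assms by (intro add_mono) auto
  finally show "real (card ?A) \<le> 3 * r / h" by (simp add: field_simps)
qed

text \<open>The factors come from the proportions of \<Omega> and its complement in the critical
  cube, from the \<open>k + 1\<close> directions, and from the lattice lines blocked by one
  ball.\<close>

definition boxing_const :: "nat \<Rightarrow> real" where
  "boxing_const k = 2 ^ (k + 3) * real (k + 1) * 3 ^ k"

text \<open>The scale is \<rho> \<open>= h * N\<close>, the edge of the critical cube. Isoperimetry
  forces a fixed multiple of \<open>N ^ k\<close> cut lines there; each carries a frontier point,
  hence meets a covering ball, and ball \<open>i\<close> blocks at most
  \<open>(3 * r i / h) ^ k\<close> lines per direction.\<close>

lemma boundary_mass_near_point:
  fixes x :: "nat \<Rightarrow> nat \<Rightarrow> real" and r :: "nat \<Rightarrow> real"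
  assumes "k \<le> n" "\<Omega> \<subseteq> RR n" "ebounded n \<Omega>" "p \<in> \<Omega>" "finite I" "\<And>i. i \<in> I \<Longrightarrow> 0 < r i"
    and cover: "Euclidean_space (Suc n) frontier_of \<Omega> \<subseteq> (\<Union>i\<in>I. eball n (x i) (r i))"
  shows "\<exists>\<rho>>0. \<rho> ^ k \<le> boxing_const k *
    (\<Sum>i | i \<in> I \<and> (\<exists>y\<in>eball n (x i) (r i). edist n p y \<le> real (k + 1) * \<rho>). r i ^ k)"
proof -
  define T where "T \<rho> = {i \<in> I. \<exists>y\<in>eball n (x i) (r i). edist n p y \<le> real (k + 1) * \<rho>}" for \<rho>
  have finT: "finite (T \<rho>)" for \<rho>
    using assms(5) by (simp add: T_def)
  \<comment> \<open>The mesh is at most every radius, as the counting of lattice points requires;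
    the 1 keeps \<open>Min\<close> meaningful for empty \<open>I\<close>.\<close>
  define h where "h = Min (insert 1 (r ` I))"
  have h: "0 < h" "\<And>i. i \<in> I \<Longrightarrow> h \<le> r i"
    using assms(5,6) by (auto simp: h_def)
  define pt where "pt z = (\<lambda>i. if i \<le> k then p i + h * real (z i) else p i)" for z :: "nat \<Rightarrow> nat"
  define f where "f z \<longleftrightarrow> pt z \<in> \<Omega>" for z
  have pt_upd: "pt (b(j := s)) = (pt b)(j := p j + h * real s)" if "j \<le> k" for b j s
    using that by (auto simp: pt_def fun_eq_iff)
  have ptR: "pt z \<in> RR n" for z
    using assms(1,2,4) by (auto simp: pt_def RR_iff subset_iff)
  have cut: "real (card (cut_lines k N f j)) \<le> (\<Sum>i\<in>T (h * real N). (3 * r i / h) ^ k)"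
    if j: "j \<le> k" for j N
  proof -
    \<comment> \<open>The shadow of ball \<open>i\<close> along axis \<open>j\<close>, enlarged to a
      product of intervals in the remaining \<open>k\<close> directions.\<close>
    define E where "E i = PiE ({..k} - {j}) (\<lambda>l. {z::nat. \<bar>(x i l - p l) - h * real z\<bar> < r i})" for i
    have E: "finite (E i)" "real (card (E i)) \<le> (3 * r i / h) ^ k" if "i \<in> I" for i
    proof -
      show "finite (E i)"
        unfolding E_def using grid_points_in_interval(1)[OF h(1) h(2)[OF that]]
        by (intro finite_PiE) auto
      have "real (card (E i)) =
          (\<Prod>l\<in>{..k} - {j}. real (card {z::nat. \<bar>(x i l - p l) - h * real z\<bar> < r i}))"
        unfolding E_def by (subst card_PiE) auto
      also have "\<dots> \<le> (\<Prod>l\<in>{..k} - {j}. 3 * r i / h)"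
        using grid_points_in_interval(2)[OF h(1) h(2)[OF that]] by (intro prod_mono) auto
      also have "\<dots> = (3 * r i / h) ^ k"
        using j by simp
      finally show "real (card (E i)) \<le> (3 * r i / h) ^ k" .
    qed
    have "cut_lines k N f j \<subseteq> (\<Union>i\<in>T (h * real N). E i)"
    proof
      fix b assume "b \<in> cut_lines k N f j"
      then obtain s t where b: "b \<in> PiE ({..k} - {j}) (\<lambda>_. {..<N})"
        and st: "s < N" "t < N" "f (b(j := s))" "\<not> f (b(j := t))"
        by (auto simp: cut_lines_def)
      have "\<exists>\<tau>\<in>closed_segment (p j + h * real s) (p j + h * real t).
          (pt b)(j := \<tau>) \<in> Euclidean_space (Suc n) frontier_of \<Omega>"
        using st j assms(1)
        by (intro segment_meets_frontier ptR) (auto simp: f_def pt_upd)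
      then obtain \<tau> where \<tau>: "\<tau> \<in> closed_segment (p j + h * real s) (p j + h * real t)"
        "(pt b)(j := \<tau>) \<in> Euclidean_space (Suc n) frontier_of \<Omega>" by blast
      define y where "y = (pt b)(j := \<tau>)"
      obtain i where i: "i \<in> I" "y \<in> eball n (x i) (r i)"
        using \<tau>(2) cover by (auto simp: y_def)
      have hN: "h * real s \<le> h * real N" "h * real t \<le> h * real N" "0 \<le> h * real s" "0 \<le> h * real t"
        using st h(1) by auto
      have \<tau>b: "\<bar>p j - \<tau>\<bar> \<le> h * real N"
        using \<tau>(1) hN by (auto simp: closed_segment_eq_real_ivl split: if_splits)
      \<comment> \<open>Coordinates beyond \<open>k\<close> agree with those of \<open>p\<close>, so
        the distance bound involves \<open>k + 1\<close> and not \<open>n\<close>.\<close>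
      have "\<bar>p l - y l\<bar> \<le> (if l \<le> k then h * real N else 0)" for l
      proof (cases "l = j")
        case True
        then show ?thesis using \<tau>b j by (simp add: y_def)
      next
        case False
        then have "b l \<le> N" if "l \<le> k"
          using b that by (auto simp: PiE_iff intro: less_imp_le)
        then show ?thesis
          using False h(1) by (auto simp: y_def pt_def abs_mult)
      qed
      then have "(\<Sum>l\<le>n. \<bar>p l - y l\<bar>) \<le> (\<Sum>l\<le>n. if l \<le> k then h * real N else 0)"
        by (intro sum_mono)
      also have "\<dots> = (\<Sum>l\<le>k. h * real N)"
        using assms(1) by (intro sum.mono_neutral_cong_right) auto
      also have "\<dots> = real (k + 1) * (h * real N)"
        by simp
      finally have "edist n p y \<le> real (k + 1) * (h * real N)"
        using edist_le_sum_abs[of n p y] by linarith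
      then have "i \<in> T (h * real N)"
        using i by (auto simp: T_def)
      moreover have "b \<in> E i"
      proof -
        have "\<bar>(x i l - p l) - h * real (b l)\<bar> < r i" if "l \<le> k" "l \<noteq> j" for l
          using coordinate_le_edist[of l n "x i" y] i(2) that assms(1)
          by (auto simp: eball_def y_def pt_def algebra_simps)
        then show ?thesis
          using b by (auto simp: E_def PiE_iff)
      qed
      ultimately show "b \<in> (\<Union>i\<in>T (h * real N). E i)" by blast
    qed
    moreover have "finite (\<Union>i\<in>T (h * real N). E i)"
      using finT E(1) by (auto simp: T_def)
    ultimately have "card (cut_lines k N f j) \<le> card (\<Union>i\<in>T (h * real N). E i)"
      by (intro card_mono)
    also have "\<dots> \<le> (\<Sum>i\<in>T (h * real N). card (E i))"
      using finT by (rule card_UN_le)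
    finally have "real (card (cut_lines k N f j)) \<le> (\<Sum>i\<in>T (h * real N). real (card (E i)))"
      by (metis of_nat_le_iff of_nat_sum)
    also have "\<dots> \<le> (\<Sum>i\<in>T (h * real N). (3 * r i / h) ^ k)"
      using E(2) by (intro sum_mono) (auto simp: T_def)
    finally show ?thesis .
  qed
  define a where "a s = card {z \<in> grid k (2 ^ s). f z}" for s
  \<comment> \<open>Since \<Omega> lies in a ball of radius \<open>R\<close>, its lattice points
    have \<open>h * real (z l) < 2 * R\<close>. Once \<open>2 ^ s\<close> exceeds
    \<open>2 * R / h\<close>, the cube of edge \<open>2 ^ Suc s\<close> has them all in its corner
    subcube of half the edge, at most half of the points.\<close>
  have sparse: "\<exists>s. 2 * a s \<le> (2 ^ s) ^ Suc k"
  proof -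
    obtain u R where u: "\<Omega> \<subseteq> eball n u R"
      using assms(3) by (auto simp: ebounded_def)
    obtain s :: nat where s: "2 * R / h < 2 ^ s"
      using real_arch_pow[of 2] by fastforce
    have "{z \<in> grid k (2 ^ Suc s). f z} \<subseteq> grid k (2 ^ s)"
    proof clarify
      fix z assume z: "z \<in> grid k (2 ^ Suc s)" "f z"
      have "edist n p (pt z) \<le> edist n u p + edist n u (pt z)"
        using edist_triangle[of n p "pt z" u] by (simp add: edist_commute)
      moreover have "edist n u p < R" "edist n u (pt z) < R"
        using u assms(4) z(2) by (auto simp: f_def eball_def)
      ultimately have d: "edist n p (pt z) < 2 * R" by linarith
      have "z l < 2 ^ s" if "l \<le> k" for l
      proof -
        have "h * real (z l) < 2 * R"
          using coordinate_le_edist[of l n p "pt z"] d that assms(1) h(1)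
          by (auto simp: pt_def abs_mult)
        then have "real (z l) < 2 * R / h"
          using h(1) by (simp add: field_simps)
        then have "real (z l) < real (2 ^ s)"
          using s by (simp only: of_nat_power of_nat_numeral)
        then show ?thesis by (rule of_nat_less_imp_less)
      qed
      then show "z \<in> grid k (2 ^ s)"
        using z(1) by (auto simp: grid_def PiE_iff)
    qed
    then have "a (Suc s) \<le> (2 ^ s) ^ Suc k"
      unfolding a_def by (metis card_grid card_mono finite_grid)
    moreover have "2 * (2 ^ s) ^ Suc k \<le> ((2::nat) ^ Suc s) ^ Suc k"
      by (simp add: power_mult_distrib)
    ultimately have "2 * a (Suc s) \<le> (2 ^ Suc s) ^ Suc k" by linarith
    then show ?thesis by blast
  qed
  define s where "s = (LEAST s. 2 * a s \<le> (2 ^ s) ^ Suc k)"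
  have s: "2 * a s \<le> (2 ^ s) ^ Suc k"
    unfolding s_def using sparse by (rule LeastI_ex)
  have "a 0 = 1"
  proof -
    have "grid k 1 = {\<lambda>i\<in>{..k}. 0}"
      by (auto simp: grid_def PiE_iff extensional_def fun_eq_iff split: if_splits)
    moreover have "f (\<lambda>i\<in>{..k}. 0)"
      using assms(4) by (auto simp: f_def pt_def cong: if_cong)
    ultimately have "{z \<in> grid k 1. f z} = {\<lambda>i\<in>{..k}. 0}" by auto
    then show ?thesis by (simp add: a_def)
  qed
  \<comment> \<open>The single point of the cube at scale 0 is \<open>p\<close> itself, so the
    critical scale has a predecessor.\<close>
  then have "s \<noteq> 0" using s by (intro notI) simp
  then obtain s' where s': "s = Suc s'" by (cases s) auto
  have "\<not> 2 * a s' \<le> (2 ^ s') ^ Suc k"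
    using not_less_Least[of s' "\<lambda>s. 2 * a s \<le> (2 ^ s) ^ Suc k"] s' by (simp add: s_def)
  moreover have "a s' \<le> a s"
  proof -
    have "grid k (2 ^ s') \<subseteq> grid k (2 ^ s)"
      unfolding grid_def s' by (intro PiE_mono) auto
    then show ?thesis
      unfolding a_def by (intro card_mono) (auto simp: finite_grid)
  qed
  \<comment> \<open>More than half of the preceding cube is in \<Omega>; doubling the edge dilutes
    this by at most \<open>2 ^ (k + 1)\<close>.\<close>
  ultimately have low: "(2 ^ s') ^ Suc k \<le> 2 * a s" by linarith
  define N :: nat where "N = 2 ^ s"
  define A where "A = real (a s)"
  define X where "X = real N ^ Suc k"
  have Npos: "0 < real N" by (simp add: N_def)
  have X: "0 < X" "2 * A \<le> X" "X \<le> 2 ^ (k + 2) * A"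
  proof -
    show "0 < X" using Npos by (simp add: X_def)
    have "real (2 * a s) \<le> real ((2 ^ s) ^ Suc k)" using s by (simp only: of_nat_le_iff)
    then show "2 * A \<le> X" by (simp add: A_def X_def N_def)
    have "real ((2 ^ s') ^ Suc k) \<le> real (2 * a s)" using low by (simp only: of_nat_le_iff)
    then have "2 ^ Suc k * (2 ^ s') ^ Suc k \<le> 2 ^ Suc k * (2 * A)"
      by (simp add: A_def)
    then show "X \<le> 2 ^ (k + 2) * A"
      by (simp add: X_def N_def s' power_mult_distrib)
  qed
  define \<Sigma> where "\<Sigma> = (\<Sum>i\<in>T (h * real N). r i ^ k)"
  have "card {z \<in> grid k N. \<not> f z} = N ^ Suc k - a s"
  proof -
    have "{z \<in> grid k N. \<not> f z} = grid k N - {z \<in> grid k N. f z}" by auto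
    then show ?thesis
      by (simp add: card_Diff_subset finite_grid card_grid a_def N_def)
  qed
  then have compl: "real (card {z \<in> grid k N. \<not> f z}) = X - A"
    using s by (simp add: of_nat_diff X_def A_def N_def)
  have "A * (X - A) = real (card {z \<in> grid k N. f z} * card {z \<in> grid k N. \<not> f z})"
    unfolding of_nat_mult compl by (simp add: A_def a_def N_def)
  then have "A * (X - A) \<le> real (N ^ (k + 2) * (\<Sum>j\<le>k. card (cut_lines k N f j)))"
    using of_nat_mono[OF grid_isoperimetry[of k N f]] by (simp only:)
  also have "\<dots> = real N * X * (\<Sum>j\<le>k. real (card (cut_lines k N f j)))"
    by (simp add: X_def)
  also have "\<dots> \<le> real N * X * (\<Sum>j\<le>k. \<Sum>i\<in>T (h * real N). (3 * r i / h) ^ k)"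
    using cut X(1) Npos by (intro mult_left_mono sum_mono) auto
  also have "(\<Sum>j\<le>k. \<Sum>i\<in>T (h * real N). (3 * r i / h) ^ k) = real (k + 1) * (3 ^ k / h ^ k * \<Sigma>)"
    by (simp add: \<Sigma>_def sum_distrib_left power_divide power_mult_distrib)
  finally have main: "A * (X - A) \<le> real N * X * (real (k + 1) * (3 ^ k / h ^ k * \<Sigma>))" .
  \<comment> \<open>Both proportions enter: \<open>A\<close> is at least
    \<open>X / 2 ^ (k + 2)\<close> and \<open>X - A\<close> at least \<open>X / 2\<close>.\<close>
  have "X * X \<le> 2 ^ (k + 3) * (A * (X - A))"
  proof -
    have "X * X \<le> (2 ^ (k + 2) * A) * (2 * (X - A))"
      using X by (intro mult_mono) (auto simp: A_def)
    then show ?thesis by (simp add: algebra_simps power_add)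
  qed
  also have "\<dots> \<le> 2 ^ (k + 3) * (real N * X * (real (k + 1) * (3 ^ k / h ^ k * \<Sigma>)))"
    using main by (intro mult_left_mono) auto
  also have "\<dots> = (X * real N) * (boxing_const k * \<Sigma> / h ^ k)"
    by (simp add: boxing_const_def)
  finally have "(X * real N) * real N ^ k \<le> (X * real N) * (boxing_const k * \<Sigma> / h ^ k)"
    by (simp add: X_def mult_ac)
  then have "real N ^ k \<le> boxing_const k * \<Sigma> / h ^ k"
    using X(1) Npos by (subst (asm) mult_le_cancel_left_pos) auto
  then have "(h * real N) ^ k \<le> boxing_const k * \<Sigma>"
    using h(1) by (simp add: field_simps power_mult_distrib)
  moreover have "0 < h * real N" using h(1) Npos by simp
  ultimately show ?thesis
    unfolding \<Sigma>_def T_def by blast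
qed

text \<open>A ball near \<open>p\<close> satisfies
  \<open>2 * r i \<le> edist n p (x i) \<le> D + r i\<close>, where
  \<open>D = real (k + 1) * \<rho>\<close>; hence \<open>r i \<le> D\<close>. Lowering the exponent
  from \<open>k\<close> to \<open>m\<close> can therefore only increase \<open>(r i / D)\<close> to
  that power. The centres lie within \<sigma> \<open>= 2 * D\<close>.\<close>

lemma boundary_mass_fractional:
  fixes x :: "nat \<Rightarrow> nat \<Rightarrow> real" and r :: "nat \<Rightarrow> real"
  assumes "k \<le> n" "0 < m" "m \<le> real k" "\<Omega> \<subseteq> RR n" "ebounded n \<Omega>" "p \<in> \<Omega>" "finite I"
    and rpos: "\<And>i. i \<in> I \<Longrightarrow> 0 < r i"
    and cover: "Euclidean_space (Suc n) frontier_of \<Omega> \<subseteq> (\<Union>i\<in>I. eball n (x i) (r i))"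
    and far: "\<And>i. i \<in> I \<Longrightarrow> 2 * r i \<le> edist n (x i) p"
  shows "\<exists>\<sigma>>0. \<exists>S\<subseteq>I. (\<forall>i\<in>S. edist n p (x i) \<le> \<sigma>) \<and>
    1 / (boxing_const k * real (k + 1) ^ k * 2 powr m) * \<sigma> powr m \<le> (\<Sum>i\<in>S. r i powr m)"
proof -
  obtain \<rho> where \<rho>: "0 < \<rho>" "\<rho> ^ k \<le> boxing_const k *
    (\<Sum>i | i \<in> I \<and> (\<exists>y\<in>eball n (x i) (r i). edist n p y \<le> real (k + 1) * \<rho>). r i ^ k)"
    using boundary_mass_near_point[of k n \<Omega> p I r x] assms by blast
  define S where "S = {i \<in> I. \<exists>y\<in>eball n (x i) (r i). edist n p y \<le> real (k + 1) * \<rho>}"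
  define D where "D = real (k + 1) * \<rho>"
  define B where "B = boxing_const k"
  have pos: "0 < D" "0 < B"
    using \<rho>(1) by (auto simp: D_def B_def boxing_const_def)
  have near: "edist n p (x i) \<le> 2 * D" "r i \<le> D" if "i \<in> S" for i
  proof -
    obtain y where y: "y \<in> eball n (x i) (r i)" "edist n p y \<le> D"
      using \<open>i \<in> S\<close> by (auto simp: S_def D_def)
    have "edist n p (x i) \<le> edist n p y + edist n (x i) y"
      using edist_triangle[of n p "x i" y] by (simp add: edist_commute)
    then have "edist n p (x i) \<le> D + r i"
      using y by (simp add: eball_def)
    moreover have "2 * r i \<le> edist n p (x i)"
      using far[of i] that by (simp add: S_def edist_commute)
    ultimately show "edist n p (x i) \<le> 2 * D" "r i \<le> D" by linarith+
  qed
  have "1 / (B * real (k + 1) ^ k) = \<rho> ^ k / (B * D ^ k)"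
    using \<rho>(1) by (simp add: D_def power_mult_distrib)
  also have "\<dots> \<le> (\<Sum>i\<in>S. r i ^ k) / D ^ k"
    using \<rho>(2) pos by (simp add: S_def B_def field_simps)
  also have "\<dots> = (\<Sum>i\<in>S. (r i / D) powr real k)"
    unfolding sum_divide_distrib using pos rpos
    by (intro sum.cong) (auto simp: S_def powr_realpow power_divide)
  also have "\<dots> \<le> (\<Sum>i\<in>S. (r i / D) powr m)"
    using near(2) pos rpos assms(3) by (intro sum_mono powr_mono') (auto simp: S_def intro: less_imp_le)
  also have "\<dots> = (\<Sum>i\<in>S. r i powr m) / D powr m"
    unfolding sum_divide_distrib using pos rpos
    by (intro sum.cong) (auto simp: S_def powr_divide less_imp_le)
  finally have "1 / (B * real (k + 1) ^ k) * D powr m \<le> (\<Sum>i\<in>S. r i powr m)"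
    using pos by (simp add: field_simps)
  moreover have "1 / (B * real (k + 1) ^ k * 2 powr m) * (2 * D) powr m
      = 1 / (B * real (k + 1) ^ k) * D powr m"
    using pos by (simp add: powr_mult)
  ultimately have "1 / (B * real (k + 1) ^ k * 2 powr m) * (2 * D) powr m \<le> (\<Sum>i\<in>S. r i powr m)"
    by linarith
  then show ?thesis
    using pos near(1) unfolding B_def
    by (intro exI[of _ "2 * D"] conjI exI[of _ S]) (auto simp: S_def)
qed

section \<open>From covers of the frontier to covers of the domain\<close>

text \<open>The first term pays for the doubled balls, the second for the selected balls of radius
  \<open>3 * \<sigma> q\<close>.\<close>

definition content_const :: "real \<Rightarrow> real" where
  "content_const m = (let k = nat \<lceil>m\<rceil> in
     2 powr m + 3 powr m * (boxing_const k * real (k + 1) ^ k * 2 powr m))"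

lemma HC_le_cover_sum:
  fixes x :: "nat \<Rightarrow> nat \<Rightarrow> real" and r :: "nat \<Rightarrow> real"
  assumes "0 < m" "m \<le> real n" "\<Omega> \<subseteq> RR n" "ebounded n \<Omega>" "finite I"
    and xr: "\<And>i. i \<in> I \<Longrightarrow> x i \<in> RR n" "\<And>i. i \<in> I \<Longrightarrow> 0 < r i"
    and cover: "Euclidean_space (Suc n) frontier_of \<Omega> \<subseteq> (\<Union>i\<in>I. eball n (x i) (r i))"
  shows "HC n m \<Omega> \<le> ennreal (content_const m * (\<Sum>i\<in>I. r i powr m))"
proof -
  define k where "k = nat \<lceil>m\<rceil>"
  have k: "k \<le> n" "m \<le> real k"
    using assms(1,2) by (auto simp: k_def ceiling_le_iff real_nat_ceiling_ge)
  define C where "C = boxing_const k * real (k + 1) ^ k * 2 powr m"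
  have C: "0 < C" by (auto simp: C_def boxing_const_def)
  \<comment> \<open>The points outside the doubled balls, where the passage to exponent
    \<open>m\<close> is available.\<close>
  define P where "P = {p \<in> \<Omega>. \<forall>i\<in>I. 2 * r i \<le> edist n (x i) p}"
  have "\<forall>p\<in>P. \<exists>\<sigma> S. 0 < \<sigma> \<and> S \<subseteq> I \<and> (\<forall>i\<in>S. edist n p (x i) \<le> \<sigma>) \<and>
      1 / C * \<sigma> powr m \<le> (\<Sum>i\<in>S. r i powr m)"
  proof
    fix p assume "p \<in> P"
    then show "\<exists>\<sigma> S. 0 < \<sigma> \<and> S \<subseteq> I \<and> (\<forall>i\<in>S. edist n p (x i) \<le> \<sigma>) \<and>
      1 / C * \<sigma> powr m \<le> (\<Sum>i\<in>S. r i powr m)"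
      using boundary_mass_fractional[OF k(1) assms(1) k(2) assms(3,4) _ assms(5) xr(2) cover, of p]
      by (auto simp: P_def C_def)
  qed
  then obtain \<sigma> S where \<sigma>S: "\<And>p. p \<in> P \<Longrightarrow> 0 < \<sigma> p" "\<And>p. p \<in> P \<Longrightarrow> S p \<subseteq> I"
    "\<And>p i. p \<in> P \<Longrightarrow> i \<in> S p \<Longrightarrow> edist n p (x i) \<le> \<sigma> p"
    "\<And>p. p \<in> P \<Longrightarrow> 1 / C * \<sigma> p powr m \<le> (\<Sum>i\<in>S p. r i powr m)"
    by metis
  have "\<exists>Q. finite Q \<and> Q \<subseteq> P \<and> (\<forall>p\<in>P. \<exists>q\<in>Q. edist n q p < 3 * \<sigma> q) \<and>
           (\<Sum>q\<in>Q. 1 / C * \<sigma> q powr m) \<le> (\<Sum>i\<in>I. r i powr m)"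
    by (rule greedy_covering[where S = S and x = x]) (use assms(1,5) C \<sigma>S in auto)
  then obtain Q where Q: "finite Q" "Q \<subseteq> P" "\<forall>p\<in>P. \<exists>q\<in>Q. edist n q p < 3 * \<sigma> q"
    "(\<Sum>q\<in>Q. 1 / C * \<sigma> q powr m) \<le> (\<Sum>i\<in>I. r i powr m)"
    by blast
  \<comment> \<open>The sum type indexes the final cover: \<open>Inl\<close> for doubled boundary
    balls, \<open>Inr\<close> for selected balls centred in \<open>P\<close>.\<close>
  define X where "X = case_sum x (\<lambda>q. q)"
  define R where "R = case_sum (\<lambda>i. 2 * r i) (\<lambda>q. 3 * \<sigma> q)"
  have PR: "P \<subseteq> RR n"
    using assms(3) by (auto simp: P_def)
  have "HC n m \<Omega> \<le> ennreal (\<Sum>j\<in>I <+> Q. R j powr m)"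
  proof (rule HC_le_finite_sum[where x = X])
    show "finite (I <+> Q)" using assms(5) Q(1) by simp
    show "X j \<in> RR n" "0 \<le> R j" if "j \<in> I <+> Q" for j
      using that xr Q(2) PR \<sigma>S(1) by (auto simp: X_def R_def less_imp_le subset_iff)
    show "\<Omega> \<subseteq> (\<Union>j\<in>I <+> Q. eball n (X j) (R j))"
    proof
      fix p assume p: "p \<in> \<Omega>"
      then have pR: "p \<in> RR n" using assms(3) by auto
      show "p \<in> (\<Union>j\<in>I <+> Q. eball n (X j) (R j))"
      proof (cases "p \<in> P")
        case True
        then obtain q where "q \<in> Q" "edist n q p < 3 * \<sigma> q" using Q(3) by blast
        then show ?thesis
          using pR by (intro UN_I[of "Inr q"]) (auto simp: eball_def X_def R_def)
      next
        case False
        then obtain i where "i \<in> I" "edist n (x i) p < 2 * r i"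
          using p by (auto simp: P_def not_le)
        then show ?thesis
          using pR by (intro UN_I[of "Inl i"]) (auto simp: eball_def X_def R_def)
      qed
    qed
  qed
  also have "(\<Sum>j\<in>I <+> Q. R j powr m) = (\<Sum>i\<in>I. (2 * r i) powr m) + (\<Sum>q\<in>Q. (3 * \<sigma> q) powr m)"
    using assms(5) Q(1) by (simp add: sum.Plus R_def)
  also have "(\<Sum>i\<in>I. (2 * r i) powr m) = 2 powr m * (\<Sum>i\<in>I. r i powr m)"
    unfolding sum_distrib_left using xr(2) by (intro sum.cong) (auto simp: powr_mult less_imp_le)
  also have "(\<Sum>q\<in>Q. (3 * \<sigma> q) powr m) = 3 powr m * C * (\<Sum>q\<in>Q. 1 / C * \<sigma> q powr m)"
    unfolding sum_distrib_left using C Q(2) \<sigma>S(1)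
    by (intro sum.cong) (auto simp: powr_mult less_imp_le subset_iff)
  also have "ennreal (2 powr m * (\<Sum>i\<in>I. r i powr m) + 3 powr m * C * (\<Sum>q\<in>Q. 1 / C * \<sigma> q powr m))
    \<le> ennreal (2 powr m * (\<Sum>i\<in>I. r i powr m) + 3 powr m * C * (\<Sum>i\<in>I. r i powr m))"
    using Q(4) C by (intro ennreal_leI add_left_mono mult_left_mono) auto
  also have "\<dots> = ennreal (content_const m * (\<Sum>i\<in>I. r i powr m))"
    by (simp add: content_const_def Let_def C_def k_def algebra_simps)
  finally show ?thesis .
qed

lemma content_const_pos: "0 < content_const m"
  by (auto simp: content_const_def Let_def boxing_const_def intro!: add_pos_nonneg)

text \<open>Compactness reduces a countable cover of the frontier to a finite one of positive radii.
  Dividing by the finite positive constant makes the bound a lower bound for the infimum.\<close>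

lemma HC_le_HC_frontier:
  assumes "0 < m" "m \<le> real n" "\<Omega> \<subseteq> RR n" "ebounded n \<Omega>"
  shows "HC n m \<Omega> \<le> ennreal (content_const m) * HC n m (Euclidean_space (Suc n) frontier_of \<Omega>)"
proof -
  let ?F = "Euclidean_space (Suc n) frontier_of \<Omega>" and ?c = "ennreal (content_const m)"
  have "HC n m \<Omega> / ?c \<le> (\<Sum>i. ennreal (r i powr m))"
    if xr: "\<forall>i. x i \<in> RR n \<and> r i \<ge> 0" and cov: "?F \<subseteq> (\<Union>i. eball n (x i) (r i))" for x and r :: "nat \<Rightarrow> real"
  proof -
    \<comment> \<open>Balls inside \<open>RR n\<close> are in general not open in the full function
      space, so compactness is applied to the unrestricted sets.\<close>
    have "?F \<subseteq> (\<Union>i\<in>{i. 0 < r i}. {y. edist n (x i) y < r i})"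
    proof
      fix y assume "y \<in> ?F"
      then obtain i where "edist n (x i) y < r i" using cov by (auto simp: eball_def)
      then show "y \<in> (\<Union>i\<in>{i. 0 < r i}. {y. edist n (x i) y < r i})"
        using edist_nonneg[of n "x i" y] by (intro UN_I[of i]) auto
    qed
    then obtain I where I: "I \<subseteq> {i. 0 < r i}" "finite I"
      "?F \<subseteq> (\<Union>i\<in>I. {y. edist n (x i) y < r i})"
      by (rule compactE_image[OF compact_frontier_of_ebounded[OF assms(4)] open_edist_less])
    have "?F \<subseteq> RR n"
      unfolding RR_def by (rule frontier_of_subset_topspace)
    then have "?F \<subseteq> (\<Union>i\<in>I. eball n (x i) (r i))"
      using I(3) by (fastforce simp: eball_def)
    then have "HC n m \<Omega> \<le> ennreal (content_const m * (\<Sum>i\<in>I. r i powr m))"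
      using assms I(1,2) xr by (intro HC_le_cover_sum) auto
    also have "\<dots> = ?c * (\<Sum>i\<in>I. ennreal (r i powr m))"
      using content_const_pos[of m] by (simp add: ennreal_mult' less_imp_le)
    also have "\<dots> \<le> ?c * (\<Sum>i. ennreal (r i powr m))"
      using I(2) by (intro mult_left_mono sum_le_suminf) auto
    finally show ?thesis
      using content_const_pos[of m] by (intro divide_le_posI_ennreal) auto
  qed
  then have "HC n m \<Omega> / ?c \<le> HC n m ?F"
    by (subst (2) HC_def) (auto intro!: Inf_greatest)
  then have "?c * (HC n m \<Omega> / ?c) \<le> ?c * HC n m ?F"
    by (rule mult_left_mono) simp
  moreover have "?c * (HC n m \<Omega> / ?c) = HC n m \<Omega>"
    using content_const_pos[of m]
    by (subst ennreal_times_divide, subst mult.commute, intro ennreal_mult_divide_eq) auto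
  ultimately show ?thesis by simp
qed

theorem theorem1p2:
  shows "\<exists>c :: real \<Rightarrow> real. (\<forall>m>0. c m > 0) \<and>
    (\<forall>(n::nat) (\<Omega> :: (nat \<Rightarrow> real) set) (m::real).
       n \<ge> 1 \<and> openin (Euclidean_space (Suc n)) \<Omega> \<and> connectedin (Euclidean_space (Suc n)) \<Omega>
       \<and> \<Omega> \<noteq> {} \<and> ebounded n \<Omega> \<and> 0 < m \<and> m \<le> real n
       \<longrightarrow> HC n m \<Omega> \<le> ennreal (c m) * HC n m (Euclidean_space (Suc n) frontier_of \<Omega>))"
proof (intro exI[of _ content_const] conjI allI impI content_const_pos)
  fix n :: nat and \<Omega> :: "(nat \<Rightarrow> real) set" and m :: real
  assume *: "n \<ge> 1 \<and> openin (Euclidean_space (Suc n)) \<Omega> \<and> connectedin (Euclidean_space (Suc n)) \<Omega>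
       \<and> \<Omega> \<noteq> {} \<and> ebounded n \<Omega> \<and> 0 < m \<and> m \<le> real n"
  then have "\<Omega> \<subseteq> RR n"
    unfolding RR_def using openin_subset by blast
  with * show "HC n m \<Omega> \<le> ennreal (content_const m) * HC n m (Euclidean_space (Suc n) frontier_of \<Omega>)"
    by (intro HC_le_HC_frontier) auto
qed

end
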